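(* Let $c>0$ be a fixed constant. There is a constant $C>0$ (depending only on $c$) such that the following holds. Let $x_1,x_2\in\mathbb{R}^d$ be vectors of unit Euclidean norm with $\|x_2-x_1\|_{\ell_2}\le\varepsilon_0$. Let $f(W,x)=v^T\phi(Wx)$ where $W\in\mathbb{R}^{k\times d}$, $k\ge cd$, $v\in\mathbb{R}^k$ is the fixed vector with half of its entries equal to $1/\sqrt k$ and the other half equal to $-1/\sqrt k$, and $|\phi'|,|\phi''|\le\Gamma$. Let $y_1,y_2$ be scalars with $|y_2-y_1|\ge\delta$. Let $W_0\in\mathbb{R}^{k\times d}$ have i.i.d. $\mathcal N(0,1)$ entries and let $t\ge0$. Then with probability at least $1-2e^{-(k+d)}-2e^{-t^2/2}$ the following holds: for every $W\in\mathbb{R}^{k\times d}$ such that $\|W-W_0\|_F\le c\sqrt k$ and $$f(W,x_1)=y_1\quad\text{and}\quad f(W,x_2)=y_2,$$ we have $$\|W-W_0\|\ge\frac{\delta}{C\Gamma\varepsilon_0}-\frac{t}{1000}.$$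
   Context: $\|\cdot\|$ is the spectral norm, $\|\cdot\|_F$ the Frobenius norm. The activation $\phi:\mathbb{R}\to\mathbb{R}$ is applied entrywise. If $k$ is odd, one entry of $v$ is set to zero and the remaining entries are split evenly between $1/\sqrt k$ and $-1/\sqrt k$. *)

theory Defs
  imports "HOL-Probability.Probability" "Jordan_Normal_Form.Matrix"
begin

text \<open>
  Matrices and vectors are those of \<^theory>\<open>Jordan_Normal_Form.Matrix\<close>, whose dimensions are
  ordinary natural numbers, so that a constant can be chosen uniformly in all dimensions.
\<close>

definition l2_norm :: "real vec \<Rightarrow> real" where
  "l2_norm x = sqrt (scalar_prod x x)"

definition frobenius_norm :: "real mat \<Rightarrow> real" where
  "frobenius_norm A = sqrt (\<Sum>i<dim_row A. \<Sum>j<dim_col A. (A $$ (i, j))\<^sup>2)"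

text \<open>
  The supremum is over the closed unit ball rather than the sphere, so that the set is nonempty
  (and the value is 0) also for matrices without columns.
\<close>

definition spectral_norm :: "real mat \<Rightarrow> real" where
  "spectral_norm A = (SUP x\<in>{x \<in> carrier_vec (dim_col A). l2_norm x \<le> 1}. l2_norm (A *\<^sub>v x))"

definition two_layer_net :: "(real \<Rightarrow> real) \<Rightarrow> real vec \<Rightarrow> real mat \<Rightarrow> real vec \<Rightarrow> real" where
  "two_layer_net \<phi> v W x = scalar_prod v (map_vec \<phi> (W *\<^sub>v x))"

text \<open>
  The positions of the signs are arbitrary. For even \<open>k\<close> the first two counts already exhaust all
  \<open>k\<close> entries; for odd \<open>k\<close> exactly one entry is left, and it is zero.
\<close>

definition balanced_output_vec :: "nat \<Rightarrow> real vec \<Rightarrow> bool" where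
  "balanced_output_vec k v \<longleftrightarrow>
     v \<in> carrier_vec k \<and>
     card {i. i < k \<and> vec_index v i = 1 / sqrt (real k)} = k div 2 \<and>
     card {i. i < k \<and> vec_index v i = - (1 / sqrt (real k))} = k div 2 \<and>
     card {i. i < k \<and> vec_index v i = 0} = k mod 2"

text \<open>
  The joint law of \<open>k \<times> d\<close> independent standard Gaussian entries, indexed by (row, column). A sample
  point \<open>\<omega>\<close> represents the random matrix \<open>mat k d \<omega>\<close>.
\<close>

definition gaussian_entries :: "nat \<Rightarrow> nat \<Rightarrow> (nat \<times> nat \<Rightarrow> real) measure" where
  "gaussian_entries k d = PiM ({..<k} \<times> {..<d}) (\<lambda>_. density lborel std_normal_density)"

end

theory Submission
  imports Defs
begin

text \<open>
  Put \<open>D = W - W\<^sub>0\<close> and \<open>h = x\<^sub>2 - x\<^sub>1\<close>. The output gap \<open>f(W, x\<^sub>2) - f(W, x\<^sub>1)\<close> differs from the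
  gap \<open>S\<close> of the initial network by a sum over the hidden units of second differences
  of \<open>\<phi>\<close>, which by the mean value theorem and Cauchy--Schwarz is at most
  \<open>\<Gamma> \<parallel>D\<parallel> (\<epsilon>\<^sub>0 + 2 \<parallel>W\<^sub>0 h\<parallel> / sqrt k)\<close>. As \<open>h\<close> is fixed, no bound on the
  operator norm of \<open>W\<^sub>0\<close> is needed: a chi-square tail gives
  \<open>\<parallel>W\<^sub>0 h\<parallel>\<^sup>2 \<le> 8 (k + d) \<epsilon>\<^sub>0\<^sup>2\<close>, and \<open>k + d \<le> (1 + 1/c) k\<close>. Finally
  \<open>S\<close> is a combination, with weights summing to zero, of independent identically
  distributed variables dominated by \<open>\<Gamma>\<close> times a Gaussian of standard deviation at most \<open>\<epsilon>\<^sub>0\<close>,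
  hence is subgaussian and at most \<open>3 \<Gamma> \<epsilon>\<^sub>0 t\<close> up to probability \<open>2 exp (- t\<^sup>2 / 2)\<close>.
\<close>

unbundle no vec_syntax

section \<open>Gaussian concentration\<close>

text \<open>Domination passes to even exponential moments, since \<open>cosh\<close> is monotone in
  the absolute value, but not to the centred variable. So the centred exponential is bounded by a
  \<open>cosh\<close> plus a linear term of mean zero, AM-GM separates \<open>X\<close> from its
  mean \<open>m\<close>, and Jensen turns the terms in \<open>m\<close> back into moments of
  \<open>X\<close>. The price is the constant 4 in place of 1/2.\<close>

lemma (in prob_space) nn_integral_exp_centered_le:
  fixes X a :: "'a \<Rightarrow> real"
  assumes [measurable]: "X \<in> borel_measurable M" "a \<in> borel_measurable M"
    and dom: "\<And>x. \<bar>X x\<bar> \<le> \<bar>a x\<bar>"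
    and mgf: "\<And>l. (\<integral>\<^sup>+x. ennreal (exp (l * a x)) \<partial>M) \<le> ennreal (exp (l\<^sup>2 * \<sigma>\<^sup>2 / 2))"
  shows "(\<integral>\<^sup>+x. ennreal (exp (l * (X x - expectation X))) \<partial>M) \<le> ennreal (exp (4 * l\<^sup>2 * \<sigma>\<^sup>2))"
proof -
  define m where "m = expectation X"
  have int_a [simp]: "integrable M (\<lambda>x. exp (u * a x))" for u
    using mgf[of u] by (intro integrableI_nonneg) (auto simp: le_less_trans)
  have E_a: "expectation (\<lambda>x. exp (u * a x)) \<le> exp (u\<^sup>2 * \<sigma>\<^sup>2 / 2)" for u
    using mgf[of u] by (intro integral_real_bounded) auto
  have cosh_mono: "exp (u * X x) + exp (- u * X x) \<le> exp (u * a x) + exp (- u * a x)" for u x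
  proof -
    have "cosh (u * X x) \<le> cosh (u * a x)"
      using dom[of x] by (subst (1 2) cosh_real_abs [symmetric], subst cosh_real_nonneg_le_iff)
        (auto simp: abs_mult mult_left_mono)
    then show ?thesis by (simp add: cosh_def)
  qed
  have int_X [simp]: "integrable M (\<lambda>x. exp (u * X x))" for u
  proof (rule Bochner_Integration.integrable_bound)
    show "integrable M (\<lambda>x. exp (u * a x) + exp (- u * a x))"
      by (intro Bochner_Integration.integrable_add int_a)
    have "exp (u * X x) \<le> exp (u * a x) + exp (- u * a x)" for x
      using cosh_mono[of u x] exp_ge_zero[of "- u * X x"] by linarith
    then show "AE x in M. norm (exp (u * X x)) \<le> norm (exp (u * a x) + exp (- u * a x))"
      by (intro AE_I2) simp
  qed simp
  \<comment> \<open>Integrability makes \<open>expectation X\<close> a genuine mean rather than the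
    default value 0 of the Bochner integral.\<close>
  have X_int [simp]: "integrable M X"
  proof (rule Bochner_Integration.integrable_bound)
    show "integrable M (\<lambda>x. exp (1 * X x) + exp ((-1) * X x))"
      by (intro Bochner_Integration.integrable_add int_X)
    have "\<bar>X x\<bar> \<le> exp (1 * X x) + exp ((-1) * X x)" for x
      using exp_ge_add_one_self[of "X x"] exp_ge_add_one_self[of "- X x"]
        exp_ge_zero[of "X x"] exp_ge_zero[of "- X x"] unfolding mult_1 mult_minus1 by linarith
    then show "AE x in M. norm (X x) \<le> norm (exp (1 * X x) + exp ((-1) * X x))"
      by (intro AE_I2) simp
  qed simp
  have jensen: "exp (u * m) \<le> expectation (\<lambda>x. exp (u * X x))" for u
  proof -
    have "expectation (\<lambda>x. exp (u * m) * (1 + u * (X x - m))) \<le> expectation (\<lambda>x. exp (u * X x))"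
    proof (rule integral_mono)
      fix x
      \<comment> \<open>The tangent line of \<open>exp\<close> at \<open>u * m\<close>; its
        expectation is \<open>exp (u * m)\<close> because \<open>X - m\<close> has mean
        zero.\<close>
      have "exp (u * m) * (1 + u * (X x - m)) \<le> exp (u * m) * exp (u * (X x - m))"
        by (intro mult_left_mono exp_ge_add_one_self) auto
      then show "exp (u * m) * (1 + u * (X x - m)) \<le> exp (u * X x)"
        by (simp add: mult_exp_exp algebra_simps)
    qed auto
    then show ?thesis by (simp add: m_def prob_space)
  qed
  define K where "K = expectation (\<lambda>x. exp (2 * l * X x) + exp (- (2 * l) * X x))"
  have K_eq: "K = expectation (\<lambda>x. exp (2 * l * X x)) + expectation (\<lambda>x. exp (- (2 * l) * X x))"
    unfolding K_def by (rule Bochner_Integration.integral_add) (rule int_X)+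
  have K_le: "K \<le> 2 * exp (2 * l\<^sup>2 * \<sigma>\<^sup>2)"
  proof -
    have "K \<le> expectation (\<lambda>x. exp (2 * l * a x) + exp (- (2 * l) * a x))"
      unfolding K_def
      by (rule integral_mono) (rule Bochner_Integration.integrable_add int_X int_a cosh_mono)+
    also have "\<dots> = expectation (\<lambda>x. exp (2 * l * a x)) + expectation (\<lambda>x. exp (- (2 * l) * a x))"
      by (rule Bochner_Integration.integral_add) (rule int_a)+
    also have "\<dots> \<le> 2 * exp (2 * l\<^sup>2 * \<sigma>\<^sup>2)"
      using E_a[of "2 * l"] E_a[of "- (2 * l)"] by (simp add: power_mult_distrib mult_ac)
    finally show ?thesis .
  qed
  \<comment> \<open>Splits the mixed exponential of \<open>l * X - l * m\<close> into separate terms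
    in \<open>X\<close> and \<open>m\<close>, at the cost of doubling the parameter; hence the
    \<open>2 * l\<close> in \<open>K\<close>.\<close>
  have amgm: "exp (p - q) \<le> (exp (2 * p) + exp (- (2 * q))) / 2" for p q :: real
  proof -
    have "exp (p - q) = exp p * exp (- q)" by (simp add: mult_exp_exp)
    moreover have "exp (2 * p) = (exp p)\<^sup>2" "exp (- (2 * q)) = (exp (- q))\<^sup>2"
      by (simp_all flip: exp_double)
    moreover have "0 \<le> (exp p - exp (- q))\<^sup>2" by simp
    ultimately show ?thesis by (simp add: power2_diff)
  qed
  have pointwise: "exp (l * (X x - m)) \<le>
      (exp (2 * l * X x) + exp (- (2 * l) * X x)) / 2 + (exp (2 * l * m) + exp (- (2 * l) * m)) / 2
      - 1 + l * (X x - m)" for x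
  proof -
    \<comment> \<open>\<open>e\<^sup>u - 1 - u \<le> 2 (cosh u - 1)\<close> is just \<open>1 - u \<le> e\<^sup>-\<^sup>u\<close>.\<close>
    have "1 - l * (X x - m) \<le> exp (l * m - l * X x)"
      using exp_ge_add_one_self[of "l * m - l * X x"] by (simp add: algebra_simps)
    moreover have "exp (l * (X x - m)) = exp (l * X x - l * m)"
      by (simp add: algebra_simps)
    ultimately show ?thesis
      using amgm[of "l * X x" "l * m"] amgm[of "l * m" "l * X x"] by (simp add: field_simps)
  qed
  have int_X2: "integrable M (\<lambda>x. exp (2 * l * X x) + exp (- (2 * l) * X x))"
    by (intro Bochner_Integration.integrable_add int_X)
  have shift: "exp (l * (X x - m)) = exp (- l * m) * exp (l * X x)" for x
    by (simp add: mult_exp_exp algebra_simps)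
  have int_c: "integrable M (\<lambda>x. exp (l * (X x - m)))"
    unfolding shift by simp
  have "expectation (\<lambda>x. exp (l * (X x - m))) \<le> expectation (\<lambda>x.
      (exp (2 * l * X x) + exp (- (2 * l) * X x)) / 2 + (exp (2 * l * m) + exp (- (2 * l) * m)) / 2
      - 1 + l * (X x - m))"
    using int_X2 by (intro integral_mono int_c pointwise) auto
  also have "\<dots> = K / 2 + (exp (2 * l * m) + exp (- (2 * l) * m)) / 2 - 1"
    using int_X2 X_int by (simp add: K_def m_def prob_space del: minus_mult_left)
  also have "\<dots> \<le> K - 1"
  proof -
    have "exp (2 * l * m) + exp (- (2 * l) * m) \<le> K"
      unfolding K_eq by (intro add_mono jensen)
    then show ?thesis by argo
  qed
  also have "\<dots> \<le> 2 * exp (2 * l\<^sup>2 * \<sigma>\<^sup>2) - 1"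
    using K_le by simp
  \<comment> \<open>By \<open>2 * y - 1 \<le> y\<^sup>2\<close>. The \<open>- 1\<close> left over
    from the linearisation is what absorbs the prefactor 2.\<close>
  also have "\<dots> \<le> (exp (2 * l\<^sup>2 * \<sigma>\<^sup>2))\<^sup>2"
    using zero_le_power2[of "exp (2 * l\<^sup>2 * \<sigma>\<^sup>2) - 1"] by (simp add: power2_diff)
  also have "\<dots> = exp (4 * l\<^sup>2 * \<sigma>\<^sup>2)"
    by (simp flip: exp_double)
  finally have "expectation (\<lambda>x. exp (l * (X x - m))) \<le> exp (4 * l\<^sup>2 * \<sigma>\<^sup>2)" .
  then show ?thesis
    using int_c by (subst nn_integral_eq_integral) (auto simp: m_def)
qed

section \<open>Independence of the rows of a random matrix\<close>

lemma measurable_row_PiM: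
  assumes "i \<in> I"
  shows "(\<lambda>\<omega>. \<lambda>j\<in>J. \<omega> (i, j)) \<in> measurable (PiM (I \<times> J) (\<lambda>_. N)) (PiM J (\<lambda>_. N))"
  using assms by (intro measurable_restrict measurable_component_singleton) auto

text \<open>The coordinates of a product measure are independent, and grouping them into the
  disjoint blocks \<open>{i} \<times> J\<close> keeps independence. Reindexing by
  \<open>Pair i\<close> shows that every row has law \<open>PiM J\<close>. This reduces both
  Chernoff bounds below to a single row.\<close>

lemma nn_integral_PiM_rows:
  assumes "prob_space N" "finite I"
    and F: "\<And>i. i \<in> I \<Longrightarrow> F i \<in> borel_measurable (PiM J (\<lambda>_. N))"
  shows "(\<integral>\<^sup>+\<omega>. (\<Prod>i\<in>I. F i (\<lambda>j\<in>J. \<omega> (i, j))) \<partial>PiM (I \<times> J) (\<lambda>_. N)) =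
    (\<Prod>i\<in>I. integral\<^sup>N (PiM J (\<lambda>_. N)) (F i))"
proof -
  let ?M = "PiM (I \<times> J) (\<lambda>_. N)" and ?R = "PiM J (\<lambda>_. N)"
  interpret N: prob_space N by fact
  interpret M: prob_space ?M by (intro prob_space_PiM assms)
  have row [measurable]: "(\<lambda>\<omega>. \<lambda>j\<in>J. \<omega> (i, j)) \<in> measurable ?M ?R" if "i \<in> I" for i
    using that by (rule measurable_row_PiM)
  have comp: "M.indep_vars (\<lambda>_. N) (\<lambda>p \<omega>. \<omega> p) (I \<times> J)"
  \<comment> \<open>The characterisation of independence by the joint law asks for a nonempty index
    set.\<close>
  proof (cases "I \<times> J = {}")
    case True
    then show ?thesis by (auto simp: M.indep_vars_def2 M.indep_sets_def)
  next
    case False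
    have "distr ?M ?M (\<lambda>\<omega>. \<lambda>p\<in>I \<times> J. \<omega> p) = distr ?M ?M (\<lambda>\<omega>. \<omega>)"
      by (rule distr_cong) (auto simp: space_PiM PiE_restrict)
    moreover have "(\<Pi>\<^sub>M p\<in>I \<times> J. distr ?M N (\<lambda>\<omega>. \<omega> p)) = ?M"
      using \<open>prob_space N\<close> by (intro PiM_cong refl distr_PiM_component) auto
    ultimately show ?thesis
      using False by (subst M.indep_vars_iff_distr_eq_PiM')
        (auto simp: distr_id intro!: measurable_component_singleton)
  qed
  have rows: "M.indep_vars (\<lambda>_. ?R) (\<lambda>i \<omega>. \<lambda>j\<in>J. \<omega> (i, j)) I"
  proof -
    have "M.indep_vars (\<lambda>i. PiM ({i} \<times> J) (\<lambda>_. N)) (\<lambda>i \<omega>. restrict (\<lambda>p. \<omega> p) ({i} \<times> J)) I"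
      by (rule M.indep_vars_restrict[OF comp]) (auto simp: disjoint_family_on_def)
    then have "M.indep_vars (\<lambda>_. ?R)
        (\<lambda>i \<omega>. (\<lambda>\<rho>. \<lambda>j\<in>J. \<rho> (i, j)) (restrict (\<lambda>p. \<omega> p) ({i} \<times> J))) I"
      by (rule M.indep_vars_compose2) (rule measurable_row_PiM, simp)
    then show ?thesis
      by (simp add: restrict_def cong: if_cong)
  qed
  have "(\<integral>\<^sup>+\<omega>. (\<Prod>i\<in>I. F i (\<lambda>j\<in>J. \<omega> (i, j))) \<partial>?M) =
      (\<Prod>i\<in>I. \<integral>\<^sup>+\<omega>. F i (\<lambda>j\<in>J. \<omega> (i, j)) \<partial>?M)"
    using F by (intro M.indep_vars_nn_integral \<open>finite I\<close> M.indep_vars_compose2[OF rows]) auto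
  also have "\<dots> = (\<Prod>i\<in>I. integral\<^sup>N ?R (F i))"
  proof (rule prod.cong[OF refl])
    fix i assume i: "i \<in> I"
    have "distr ?M ?R (\<lambda>\<omega>. \<lambda>j\<in>J. \<omega> (i, j)) = ?R"
      using distr_PiM_reindex[of "I \<times> J" "\<lambda>_. N" "Pair i" J] i \<open>prob_space N\<close>
      by (auto simp: inj_on_def)
    then show "(\<integral>\<^sup>+\<omega>. F i (\<lambda>j\<in>J. \<omega> (i, j)) \<partial>?M) = integral\<^sup>N ?R (F i)"
      using nn_integral_distr[OF row[OF i], of "F i"] F[OF i] by simp
  qed
  finally show ?thesis .
qed

section \<open>Exponential moments and tail bounds for Gaussian rows\<close>

abbreviation std_normal :: "real measure" where
  "std_normal \<equiv> density lborel std_normal_density"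

lemma prob_space_std_normal: "prob_space std_normal"
  by (rule prob_space_normal_density) simp

lemma nn_integral_normal_density:
  assumes "\<sigma> > 0"
  shows "(\<integral>\<^sup>+x. ennreal (normal_density \<mu> \<sigma> x) \<partial>lborel) = 1"
  using assms by (subst nn_integral_eq_integral) auto

lemma nn_integral_exp_std_normal:
  "(\<integral>\<^sup>+x. ennreal (exp (l * x)) \<partial>std_normal) = ennreal (exp (l\<^sup>2 / 2))"
proof -
  \<comment> \<open>Completing the square: the exponential tilt shifts the mean to
    \<open>l\<close>.\<close>
  have "std_normal_density x * exp (l * x) = exp (l\<^sup>2 / 2) * normal_density l 1 x" for x
    by (simp add: normal_density_def mult_exp_exp field_simps power2_eq_square)
  then have "(\<integral>\<^sup>+x. ennreal (exp (l * x)) \<partial>std_normal) =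
      (\<integral>\<^sup>+x. ennreal (exp (l\<^sup>2 / 2)) * ennreal (normal_density l 1 x) \<partial>lborel)"
    by (subst nn_integral_density) (auto simp flip: ennreal_mult)
  also have "\<dots> = ennreal (exp (l\<^sup>2 / 2))"
    by (subst nn_integral_cmult) (auto simp: nn_integral_normal_density)
  finally show ?thesis .
qed

lemma nn_integral_exp_square_std_normal:
  "(\<integral>\<^sup>+x. ennreal (exp (x\<^sup>2 / 4)) \<partial>std_normal) = ennreal (sqrt 2)"
proof -
  \<comment> \<open>The tilt halves the Gaussian exponent, which doubles the variance;
    \<open>sqrt 2\<close> corrects the normalisation.\<close>
  have "std_normal_density x * exp (x\<^sup>2 / 4) = sqrt 2 * normal_density 0 (sqrt 2) x" for x
    by (simp add: normal_density_def mult_exp_exp field_simps real_sqrt_mult)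
  then have "(\<integral>\<^sup>+x. ennreal (exp (x\<^sup>2 / 4)) \<partial>std_normal) =
      (\<integral>\<^sup>+x. ennreal (sqrt 2) * ennreal (normal_density 0 (sqrt 2) x) \<partial>lborel)"
    by (subst nn_integral_density) (auto simp flip: ennreal_mult)
  also have "\<dots> = ennreal (sqrt 2)"
    by (subst nn_integral_cmult) (auto simp: nn_integral_normal_density)
  finally show ?thesis .
qed

lemma borel_measurable_linear_PiM [measurable]:
  "(\<lambda>r. \<Sum>j\<in>J. h j * r j) \<in> borel_measurable (PiM J (\<lambda>_. std_normal))"
  by (intro borel_measurable_sum borel_measurable_times borel_measurable_const)
    (use measurable_component_singleton[of _ J "\<lambda>_. std_normal"] in simp)

lemma nn_integral_exp_linear_gaussian:
  assumes "finite J"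
  shows "(\<integral>\<^sup>+r. ennreal (exp (\<Sum>j\<in>J. h j * r j)) \<partial>PiM J (\<lambda>_. std_normal)) =
    ennreal (exp ((\<Sum>j\<in>J. (h j)\<^sup>2) / 2))"
proof -
  interpret product_sigma_finite "\<lambda>_. std_normal"
    using prob_space_std_normal
    by (auto simp: product_sigma_finite_def prob_space_imp_sigma_finite)
  have "(\<integral>\<^sup>+r. ennreal (exp (\<Sum>j\<in>J. h j * r j)) \<partial>PiM J (\<lambda>_. std_normal)) =
      (\<integral>\<^sup>+r. (\<Prod>j\<in>J. ennreal (exp (h j * r j))) \<partial>PiM J (\<lambda>_. std_normal))"
    using assms by (simp add: exp_sum prod_ennreal)
  also have "\<dots> = (\<Prod>j\<in>J. ennreal (exp ((h j)\<^sup>2 / 2)))"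
    using assms by (subst product_nn_integral_prod) (auto simp: nn_integral_exp_std_normal)
  also have "\<dots> = ennreal (exp ((\<Sum>j\<in>J. (h j)\<^sup>2) / 2))"
    using assms by (simp add: prod_ennreal exp_sum sum_divide_distrib)
  finally show ?thesis .
qed

text \<open>The law of the linear form need not be identified: once the square is linearised and the
  integrals are swapped, only the exponential moment of the form enters, and a one-dimensional
  integral of \<open>exp (g\<^sup>2 / 4)\<close> remains.\<close>

lemma nn_integral_exp_square_linear_gaussian:
  assumes "finite J" and "e > 0" and h: "(\<Sum>j\<in>J. (h j)\<^sup>2) \<le> e\<^sup>2"
  shows "(\<integral>\<^sup>+r. ennreal (exp ((\<Sum>j\<in>J. h j * r j)\<^sup>2 / (4 * e\<^sup>2))) \<partial>PiM J (\<lambda>_. std_normal))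
    \<le> ennreal (sqrt 2)"
proof -
  let ?R = "PiM J (\<lambda>_. std_normal)"
  interpret R: prob_space ?R by (intro prob_space_PiM prob_space_std_normal)
  interpret N: prob_space std_normal by (rule prob_space_std_normal)
  interpret pair_sigma_finite ?R std_normal ..
  \<comment> \<open>Linearising the square by an independent Gaussian \<open>g\<close>: \<open>exp (s\<^sup>2 / 2)\<close> is the expectation of \<open>exp (s * g)\<close>.\<close>
  have "ennreal (exp ((\<Sum>j\<in>J. h j * r j)\<^sup>2 / (4 * e\<^sup>2))) =
      (\<integral>\<^sup>+g. ennreal (exp ((\<Sum>j\<in>J. h j * r j) / (sqrt 2 * e) * g)) \<partial>std_normal)" for r
    using \<open>e > 0\<close> by (subst nn_integral_exp_std_normal) (simp add: power_divide power_mult_distrib)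
  then have "(\<integral>\<^sup>+r. ennreal (exp ((\<Sum>j\<in>J. h j * r j)\<^sup>2 / (4 * e\<^sup>2))) \<partial>?R) =
      (\<integral>\<^sup>+r. \<integral>\<^sup>+g. ennreal (exp ((\<Sum>j\<in>J. h j * r j) / (sqrt 2 * e) * g)) \<partial>std_normal \<partial>?R)"
    by simp
  also have "\<dots> =
      (\<integral>\<^sup>+g. \<integral>\<^sup>+r. ennreal (exp ((\<Sum>j\<in>J. h j * r j) / (sqrt 2 * e) * g)) \<partial>?R \<partial>std_normal)"
    by (rule Fubini'[symmetric]) measurable
  also have "\<dots> = (\<integral>\<^sup>+g. ennreal (exp ((\<Sum>j\<in>J. (h j * (g / (sqrt 2 * e)))\<^sup>2) / 2)) \<partial>std_normal)"
    by (subst nn_integral_exp_linear_gaussian[OF \<open>finite J\<close>, symmetric])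
      (simp add: sum_distrib_left sum_distrib_right sum_divide_distrib mult_ac)
  also have "\<dots> \<le> (\<integral>\<^sup>+g. ennreal (exp (g\<^sup>2 / 4)) \<partial>std_normal)"
  proof (intro nn_integral_mono ennreal_leI)
    fix g :: real
    have "(\<Sum>j\<in>J. (h j * (g / (sqrt 2 * e)))\<^sup>2) = (\<Sum>j\<in>J. (h j)\<^sup>2) * (g\<^sup>2 / (2 * e\<^sup>2))"
      by (simp add: power_mult_distrib power_divide sum_distrib_right sum_divide_distrib)
    also have "\<dots> \<le> e\<^sup>2 * (g\<^sup>2 / (2 * e\<^sup>2))"
      by (intro mult_right_mono h) auto
    also have "\<dots> = g\<^sup>2 / 2" using \<open>e > 0\<close> by simp
    finally show "exp ((\<Sum>j\<in>J. (h j * (g / (sqrt 2 * e)))\<^sup>2) / 2) \<le> exp (g\<^sup>2 / 4)" by simp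
  qed
  also have "\<dots> = ennreal (sqrt 2)" by (rule nn_integral_exp_square_std_normal)
  finally show ?thesis .
qed

text \<open>Chernoff with parameter \<open>1 / (4 * e\<^sup>2)\<close>: the threshold contributes
  \<open>exp (- 2 * n)\<close>, and each row contributes a factor at most \<open>sqrt 2\<close>,
  which is below \<open>exp 1\<close>, so all rows together cost at most
  \<open>exp n\<close>.\<close>

lemma prob_sum_rows_square_ge:
  assumes "finite I" "finite J" and "e > 0" and h: "(\<Sum>j\<in>J. (h j)\<^sup>2) \<le> e\<^sup>2" and "real (card I) \<le> n"
  defines "M \<equiv> PiM (I \<times> J) (\<lambda>_. std_normal)"
  shows "measure M {\<omega>\<in>space M. (\<Sum>i\<in>I. (\<Sum>j\<in>J. h j * \<omega> (i, j))\<^sup>2) \<ge> 8 * n * e\<^sup>2} \<le> exp (- n)"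
proof -
  interpret M: prob_space M
    unfolding M_def by (intro prob_space_PiM prob_space_std_normal)
  \<comment> \<open>Written through the restricted row so that the measurability and factorisation
    lemmas for rows apply; \<open>a_eq\<close> removes the restriction.\<close>
  let ?a = "\<lambda>i \<omega>. \<Sum>j\<in>J. h j * (\<lambda>j\<in>J. \<omega> (i, j)) j"
  have a_eq: "?a i \<omega> = (\<Sum>j\<in>J. h j * \<omega> (i, j))" for i \<omega>
    by (rule sum.cong) auto
  have [measurable]: "?a i \<in> borel_measurable M" if "i \<in> I" for i
    using measurable_compose[OF measurable_row_PiM borel_measurable_linear_PiM] that
    unfolding M_def by fast
  then have [measurable]: "(\<lambda>\<omega>. \<Sum>j\<in>J. h j * \<omega> (i, j)) \<in> borel_measurable M" if "i \<in> I" for i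
    using that unfolding a_eq by fast
  have [measurable]: "(\<lambda>\<omega>. \<Sum>i\<in>I. (?a i \<omega>)\<^sup>2) \<in> borel_measurable M"
    by measurable
  have "emeasure M {\<omega>\<in>space M. (\<Sum>i\<in>I. (?a i \<omega>)\<^sup>2) \<ge> 8 * n * e\<^sup>2} \<le>
      ennreal (exp (- (1 / (4 * e\<^sup>2)) * (8 * n * e\<^sup>2))) *
      (\<integral>\<^sup>+\<omega>\<in>space M. ennreal (exp (1 / (4 * e\<^sup>2) * (\<Sum>i\<in>I. (?a i \<omega>)\<^sup>2))) \<partial>M)"
    using \<open>e > 0\<close> by (intro Chernoff_ineq_nn_integral_ge) auto
  also have "(\<integral>\<^sup>+\<omega>\<in>space M. ennreal (exp (1 / (4 * e\<^sup>2) * (\<Sum>i\<in>I. (?a i \<omega>)\<^sup>2))) \<partial>M) =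
      (\<integral>\<^sup>+\<omega>. (\<Prod>i\<in>I. ennreal (exp ((?a i \<omega>)\<^sup>2 / (4 * e\<^sup>2)))) \<partial>M)"
    using \<open>finite I\<close> by (intro nn_integral_cong)
      (simp add: prod_ennreal exp_sum sum_divide_distrib)
  also have "\<dots> = (\<Prod>i\<in>I. \<integral>\<^sup>+r. ennreal (exp ((\<Sum>j\<in>J. h j * r j)\<^sup>2 / (4 * e\<^sup>2)))
      \<partial>PiM J (\<lambda>_. std_normal))"
    unfolding M_def using \<open>finite I\<close> prob_space_std_normal
    by (intro nn_integral_PiM_rows
      [where F = "\<lambda>_ r. ennreal (exp ((\<Sum>j\<in>J. h j * r j)\<^sup>2 / (4 * e\<^sup>2)))"]) auto
  also have "\<dots> \<le> (\<Prod>i\<in>I. ennreal (sqrt 2))"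
    using nn_integral_exp_square_linear_gaussian[OF \<open>finite J\<close> \<open>e > 0\<close> h]
    by (intro prod_mono_ennreal) auto
  also have "(\<Prod>i\<in>I. ennreal (sqrt 2)) = ennreal (sqrt 2 ^ card I)"
    by (simp add: ennreal_power)
  also have "\<dots> \<le> ennreal (exp n)"
  proof (rule ennreal_leI)
    have "sqrt 2 ^ card I \<le> exp 1 ^ card I"
      using exp_ge_add_one_self[of 1] real_le_lsqrt[of 2 2] by (intro power_mono) auto
    also have "\<dots> = exp (real (card I))"
      by (simp flip: exp_of_nat_mult)
    also have "\<dots> \<le> exp n"
      using \<open>real (card I) \<le> n\<close> by simp
    finally show "sqrt 2 ^ card I \<le> exp n" .
  qed
  also have "ennreal (exp (- (1 / (4 * e\<^sup>2)) * (8 * n * e\<^sup>2))) * ennreal (exp n) = ennreal (exp (- n))"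
    using \<open>e > 0\<close> by (simp add: mult_exp_exp flip: ennreal_mult)
  finally show ?thesis
    unfolding a_eq by (simp add: M.emeasure_eq_measure mult_left_mono)
qed

text \<open>The variables \<open>g\<close> of the rows are independent with a common law and mean.
  Zero-sum weights allow centring, the bound for centred dominated variables applies to each row
  with parameter \<open>s * v i\<close>, and the squared weights add up to at most 1.\<close>

lemma prob_weighted_sum_rows_ge:
  assumes "finite I" "finite J" and "\<sigma> > 0" and h: "(\<Sum>j\<in>J. (h j)\<^sup>2) \<le> \<sigma>\<^sup>2"
    and g [measurable]: "g \<in> borel_measurable (PiM J (\<lambda>_. std_normal))"
    and dom: "\<And>r. \<bar>g r\<bar> \<le> \<bar>\<Sum>j\<in>J. h j * r j\<bar>"
    and v0: "(\<Sum>i\<in>I. v i) = 0" and v2: "(\<Sum>i\<in>I. (v i)\<^sup>2) \<le> 1" and "t \<ge> 0"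
  defines "M \<equiv> PiM (I \<times> J) (\<lambda>_. std_normal)"
  shows "measure M {\<omega>\<in>space M. (\<Sum>i\<in>I. v i * g (\<lambda>j\<in>J. \<omega> (i, j))) \<ge> 3 * \<sigma> * t} \<le> exp (- (t\<^sup>2 / 2))"
proof -
  let ?R = "PiM J (\<lambda>_. std_normal)"
  interpret M: prob_space M
    unfolding M_def by (intro prob_space_PiM prob_space_std_normal)
  interpret R: prob_space ?R
    by (intro prob_space_PiM prob_space_std_normal)
  show ?thesis
  \<comment> \<open>At \<open>t = 0\<close> the bound is 1; the Chernoff parameter must be positive
    otherwise.\<close>
  proof (cases "t = 0")
    case True
    then show ?thesis by simp
  next
    case False
    \<comment> \<open>Close to the optimum \<open>3 * t / (8 * \<sigma>)\<close>. The exponent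
      becomes \<open>- t\<^sup>2 + 4 * t\<^sup>2 / 9\<close>, which is below
      \<open>- t\<^sup>2 / 2\<close>.\<close>
    define s m where "s = t / (3 * \<sigma>)" and "m = R.expectation g"
    have "s > 0" using False \<open>t \<ge> 0\<close> \<open>\<sigma> > 0\<close> by (simp add: s_def)
    let ?X = "\<lambda>i \<omega>. g (\<lambda>j\<in>J. \<omega> (i, j))"
    have [measurable]: "?X i \<in> borel_measurable M" if "i \<in> I" for i
      using measurable_compose[OF measurable_row_PiM g] that unfolding M_def by fast
    have mgf: "(\<integral>\<^sup>+r. ennreal (exp (l * (g r - m))) \<partial>?R) \<le> ennreal (exp (4 * l\<^sup>2 * \<sigma>\<^sup>2))" for l
      unfolding m_def
    proof (rule R.nn_integral_exp_centered_le)
      fix u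
      have "(\<integral>\<^sup>+r. ennreal (exp (u * (\<Sum>j\<in>J. h j * r j))) \<partial>?R) =
          ennreal (exp ((\<Sum>j\<in>J. (u * h j)\<^sup>2) / 2))"
        by (subst nn_integral_exp_linear_gaussian[OF \<open>finite J\<close>, symmetric])
          (simp add: sum_distrib_left mult_ac)
      also have "\<dots> \<le> ennreal (exp (u\<^sup>2 * \<sigma>\<^sup>2 / 2))"
        using h by (intro ennreal_leI) (simp add: power_mult_distrib mult_left_mono flip: sum_distrib_left)
      finally show "(\<integral>\<^sup>+r. ennreal (exp (u * (\<Sum>j\<in>J. h j * r j))) \<partial>?R) \<le>
          ennreal (exp (u\<^sup>2 * \<sigma>\<^sup>2 / 2))" .
    qed (use dom in simp_all)
    \<comment> \<open>Since the weights sum to zero, the common mean of the rows may be subtracted.\<close>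
    have centre: "(\<Sum>i\<in>I. v i * ?X i \<omega>) = (\<Sum>i\<in>I. v i * (?X i \<omega> - m))" for \<omega>
      using v0 by (simp add: right_diff_distrib sum_subtractf flip: sum_distrib_right)
    have "emeasure M {\<omega>\<in>space M. (\<Sum>i\<in>I. v i * ?X i \<omega>) \<ge> 3 * \<sigma> * t} \<le>
        ennreal (exp (- s * (3 * \<sigma> * t))) *
        (\<integral>\<^sup>+\<omega>\<in>space M. ennreal (exp (s * (\<Sum>i\<in>I. v i * ?X i \<omega>))) \<partial>M)"
      using \<open>s > 0\<close> by (intro Chernoff_ineq_nn_integral_ge) auto
    also have "(\<integral>\<^sup>+\<omega>\<in>space M. ennreal (exp (s * (\<Sum>i\<in>I. v i * ?X i \<omega>))) \<partial>M) =
        (\<integral>\<^sup>+\<omega>. (\<Prod>i\<in>I. ennreal (exp (s * v i * (?X i \<omega> - m)))) \<partial>M)"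
      using \<open>finite I\<close> by (intro nn_integral_cong)
        (simp add: centre prod_ennreal exp_sum sum_distrib_left mult.assoc)
    also have "\<dots> = (\<Prod>i\<in>I. \<integral>\<^sup>+r. ennreal (exp (s * v i * (g r - m))) \<partial>?R)"
      unfolding M_def using \<open>finite I\<close> prob_space_std_normal
      by (intro nn_integral_PiM_rows[where F = "\<lambda>i r. ennreal (exp (s * v i * (g r - m)))"]) auto
    also have "\<dots> \<le> (\<Prod>i\<in>I. ennreal (exp (4 * (s * v i)\<^sup>2 * \<sigma>\<^sup>2)))"
      by (intro prod_mono_ennreal mgf)
    also have "\<dots> = ennreal (exp (4 * s\<^sup>2 * \<sigma>\<^sup>2 * (\<Sum>i\<in>I. (v i)\<^sup>2)))"
      using \<open>finite I\<close>
      by (simp add: prod_ennreal exp_sum sum_distrib_left power_mult_distrib mult_ac)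
    also have "\<dots> \<le> ennreal (exp (4 * s\<^sup>2 * \<sigma>\<^sup>2))"
      using v2 mult_left_mono[of "\<Sum>i\<in>I. (v i)\<^sup>2" 1 "4 * s\<^sup>2 * \<sigma>\<^sup>2"] by (intro ennreal_leI) simp
    also have "ennreal (exp (- s * (3 * \<sigma> * t))) * ennreal (exp (4 * s\<^sup>2 * \<sigma>\<^sup>2)) =
        ennreal (exp (- (5 * t\<^sup>2 / 9)))"
      using \<open>\<sigma> > 0\<close> by (simp add: s_def mult_exp_exp field_simps power2_eq_square flip: ennreal_mult)
    also have "\<dots> \<le> ennreal (exp (- (t\<^sup>2 / 2)))"
      by (intro ennreal_leI) simp
    finally show ?thesis
      by (simp add: M.emeasure_eq_measure mult_left_mono restrict_def)
  qed
qed

section \<open>Deterministic bounds\<close>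

text \<open>The mean value theorem is applied once, to the difference of \<phi> along the perturbed
  segment \<open>A\<close> and the unperturbed segment \<open>B\<close>, so that both derivatives
  sit at the same parameter \<open>z\<close>. Then \<open>A z - B z\<close> is a convex combination
  of \<open>q1\<close> and \<open>q2\<close>. In the application \<open>p1\<close>,
  \<open>p2\<close> are initial preactivations and \<open>q1\<close>, \<open>q2\<close> their
  perturbations; every term of the bound carries a difference between the two inputs.\<close>

lemma second_difference_bound:
  fixes \<phi> \<phi>' \<phi>'' :: "real \<Rightarrow> real"
  assumes \<phi>': "\<And>z. (\<phi> has_real_derivative \<phi>' z) (at z)"
    and \<phi>'': "\<And>z. (\<phi>' has_real_derivative \<phi>'' z) (at z)"
    and b1: "\<And>z. \<bar>\<phi>' z\<bar> \<le> \<Gamma>" and b2: "\<And>z. \<bar>\<phi>'' z\<bar> \<le> \<Gamma>"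
  shows "\<bar>(\<phi> (p2 + q2) - \<phi> (p1 + q1)) - (\<phi> p2 - \<phi> p1)\<bar>
    \<le> \<Gamma> * \<bar>q2 - q1\<bar> + \<Gamma> * (\<bar>q1\<bar> + \<bar>q2\<bar>) * \<bar>p2 - p1\<bar>"
proof -
  define A B where "A z = p1 + q1 + z * (p2 - p1 + (q2 - q1))" and "B z = p1 + z * (p2 - p1)" for z
  have "\<exists>z>0. z < 1 \<and> (\<phi> (A 1) - \<phi> (B 1)) - (\<phi> (A 0) - \<phi> (B 0)) =
      (1 - 0) * (\<phi>' (A z) * (p2 - p1 + (q2 - q1)) - \<phi>' (B z) * (p2 - p1))"
    unfolding A_def B_def
    by (rule MVT2) (auto intro!: derivative_eq_intros DERIV_chain2[OF \<phi>'])
  then obtain z where z: "0 < z" "z < 1"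
    and eq: "(\<phi> (A 1) - \<phi> (B 1)) - (\<phi> (A 0) - \<phi> (B 0)) =
      \<phi>' (A z) * (p2 - p1 + (q2 - q1)) - \<phi>' (B z) * (p2 - p1)"
    by auto
  have "\<bar>\<phi>' (A z) - \<phi>' (B z)\<bar> \<le> \<Gamma> * \<bar>A z - B z\<bar>"
    using field_differentiable_bound[of UNIV \<phi>' \<phi>'' \<Gamma> "A z" "B z"] \<phi>'' b2 by auto
  also have "A z - B z = (1 - z) * q1 + z * q2"
    by (simp add: A_def B_def algebra_simps)
  also have "\<Gamma> * \<bar>(1 - z) * q1 + z * q2\<bar> \<le> \<Gamma> * (\<bar>q1\<bar> + \<bar>q2\<bar>)"
  proof (rule mult_left_mono)
    have "\<bar>(1 - z) * q1 + z * q2\<bar> \<le> (1 - z) * \<bar>q1\<bar> + z * \<bar>q2\<bar>"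
      using z by (intro order.trans[OF abs_triangle_ineq]) (simp add: abs_mult)
    also have "\<dots> \<le> 1 * \<bar>q1\<bar> + 1 * \<bar>q2\<bar>"
      using z by (intro add_mono mult_right_mono) auto
    finally show "\<bar>(1 - z) * q1 + z * q2\<bar> \<le> \<bar>q1\<bar> + \<bar>q2\<bar>" by simp
    show "0 \<le> \<Gamma>" using b1[of 0] by linarith
  qed
  finally have lip: "\<bar>\<phi>' (A z) - \<phi>' (B z)\<bar> \<le> \<Gamma> * (\<bar>q1\<bar> + \<bar>q2\<bar>)" .
  have "(\<phi> (p2 + q2) - \<phi> (p1 + q1)) - (\<phi> p2 - \<phi> p1) =
      \<phi>' (A z) * (q2 - q1) + (\<phi>' (A z) - \<phi>' (B z)) * (p2 - p1)"
    using eq by (simp add: A_def B_def algebra_simps)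
  also have "\<bar>\<dots>\<bar> \<le> \<bar>\<phi>' (A z)\<bar> * \<bar>q2 - q1\<bar> + \<bar>\<phi>' (A z) - \<phi>' (B z)\<bar> * \<bar>p2 - p1\<bar>"
    by (metis abs_mult abs_triangle_ineq)
  also have "\<dots> \<le> \<Gamma> * \<bar>q2 - q1\<bar> + \<Gamma> * (\<bar>q1\<bar> + \<bar>q2\<bar>) * \<bar>p2 - p1\<bar>"
    by (intro add_mono mult_right_mono b1 lip) auto
  finally show ?thesis .
qed

section \<open>Euclidean and spectral norms\<close>

lemma l2_norm_eq_L2_set:
  "x \<in> carrier_vec n \<Longrightarrow> l2_norm x = L2_set (\<lambda>i. x $ i) {..<n}"
  by (auto simp: l2_norm_def L2_set_def scalar_prod_def power2_eq_square lessThan_atLeast0)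

lemma l2_norm_nonneg: "0 \<le> l2_norm x"
  by (simp add: l2_norm_eq_L2_set[of x "dim_vec x"])

lemma l2_norm_smult: "l2_norm (a \<cdot>\<^sub>v x) = \<bar>a\<bar> * l2_norm x"
  by (simp add: l2_norm_def real_sqrt_mult flip: mult.assoc)

lemma index_mult_mat_vec_sum:
  fixes A :: "real mat"
  assumes "A \<in> carrier_mat k d" "x \<in> carrier_vec d" "i < k"
  shows "(A *\<^sub>v x) $ i = (\<Sum>j<d. x $ j * A $$ (i, j))"
  using assms by (auto simp: scalar_prod_def lessThan_atLeast0 mult.commute intro!: sum.cong)

text \<open>A crude bound by Cauchy-Schwarz in each row. It shows that the supremum in
  \<open>spectral_norm\<close> is over a bounded set, and it settles vectors of norm zero, which
  cannot be rescaled.\<close>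

lemma l2_norm_mult_mat_vec_le:
  assumes A: "A \<in> carrier_mat k d" and x: "x \<in> carrier_vec d"
  shows "l2_norm (A *\<^sub>v x) \<le> (\<Sum>i<k. L2_set (\<lambda>j. A $$ (i, j)) {..<d}) * l2_norm x"
proof -
  have "l2_norm (A *\<^sub>v x) = L2_set (\<lambda>i. (A *\<^sub>v x) $ i) {..<k}"
    using A x by (intro l2_norm_eq_L2_set mult_mat_vec_carrier)
  also have "\<dots> \<le> (\<Sum>i<k. \<bar>(A *\<^sub>v x) $ i\<bar>)"
    by (rule L2_set_le_sum_abs)
  also have "\<dots> \<le> (\<Sum>i<k. L2_set (\<lambda>j. A $$ (i, j)) {..<d} * l2_norm x)"
  proof (rule sum_mono)
    fix i assume "i \<in> {..<k}"
    then have "\<bar>(A *\<^sub>v x) $ i\<bar> \<le> (\<Sum>j<d. \<bar>x $ j\<bar> * \<bar>A $$ (i, j)\<bar>)"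
      using index_mult_mat_vec_sum[OF A x, of i] by (simp add: sum_abs[THEN order.trans] abs_mult)
    also have "\<dots> \<le> l2_norm x * L2_set (\<lambda>j. A $$ (i, j)) {..<d}"
      using L2_set_mult_ineq by (simp add: l2_norm_eq_L2_set[OF x])
    finally show "\<bar>(A *\<^sub>v x) $ i\<bar> \<le> L2_set (\<lambda>j. A $$ (i, j)) {..<d} * l2_norm x"
      by (simp add: mult.commute)
  qed
  finally show ?thesis by (simp add: sum_distrib_right)
qed

lemma spectral_norm_upper:
  assumes A: "A \<in> carrier_mat k d" and x: "x \<in> carrier_vec d" "l2_norm x \<le> 1"
  shows "l2_norm (A *\<^sub>v x) \<le> spectral_norm A"
  unfolding spectral_norm_def
proof (rule cSUP_upper)
  show "x \<in> {x \<in> carrier_vec (dim_col A). l2_norm x \<le> 1}"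
    using A x by auto
  show "bdd_above ((\<lambda>x. l2_norm (A *\<^sub>v x)) ` {x \<in> carrier_vec (dim_col A). l2_norm x \<le> 1})"
  proof (rule bdd_aboveI2)
    fix y assume "y \<in> {x \<in> carrier_vec (dim_col A). l2_norm x \<le> 1}"
    then show "l2_norm (A *\<^sub>v y) \<le> (\<Sum>i<k. L2_set (\<lambda>j. A $$ (i, j)) {..<d})"
      using A by (intro order.trans[OF l2_norm_mult_mat_vec_le[OF A]] mult_left_le)
        (auto intro!: sum_nonneg)
  qed
qed

lemma spectral_norm_nonneg: "0 \<le> spectral_norm A"
proof -
  have "l2_norm (A *\<^sub>v 0\<^sub>v (dim_col A)) \<le> spectral_norm A"
    by (rule spectral_norm_upper) (auto simp: l2_norm_def)
  then show ?thesis
    using l2_norm_nonneg order.trans by blast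
qed

lemma l2_norm_mult_mat_vec_le_spectral_norm:
  assumes A: "A \<in> carrier_mat k d" and x: "x \<in> carrier_vec d"
  shows "l2_norm (A *\<^sub>v x) \<le> spectral_norm A * l2_norm x"
proof (cases "l2_norm x = 0")
  case True
  then show ?thesis using l2_norm_mult_mat_vec_le[OF A x] by simp
next
  case False
  then have pos: "l2_norm x > 0" using l2_norm_nonneg[of x] by simp
  have "l2_norm (A *\<^sub>v ((1 / l2_norm x) \<cdot>\<^sub>v x)) \<le> spectral_norm A"
    using x pos by (intro spectral_norm_upper[OF A]) (auto simp: l2_norm_smult)
  also have "A *\<^sub>v ((1 / l2_norm x) \<cdot>\<^sub>v x) = (1 / l2_norm x) \<cdot>\<^sub>v (A *\<^sub>v x)"
    using A x by (rule mult_mat_vec)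
  finally show ?thesis
    using pos by (simp add: l2_norm_smult field_simps)
qed

section \<open>Output weights and stability of the output gap\<close>

text \<open>The three counts add up to \<open>k\<close>, so the three level sets partition the
  indices, and the sum of any function of the entries depends only on the counts
  (\<open>split\<close>), whatever the positions of the signs.\<close>

lemma balanced_output_vec_abs_sums:
  assumes "balanced_output_vec k v"
  shows "\<And>i. i < k \<Longrightarrow> \<bar>v $ i\<bar> \<le> 1 / sqrt k"
    and "(\<Sum>i<k. v $ i) = 0" and "(\<Sum>i<k. (v $ i)\<^sup>2) \<le> 1"
proof -
  define a where "a = 1 / sqrt (real k)"
  define P N Z where "P = {i. i < k \<and> v $ i = a}" and "N = {i. i < k \<and> v $ i = - a}"
    and "Z = {i. i < k \<and> v $ i = 0}"
  have card: "card P = k div 2" "card N = k div 2" "card Z = k mod 2"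
    using assms by (auto simp: balanced_output_vec_def P_def N_def Z_def a_def)
  have fin: "finite P" "finite N" "finite Z"
    by (auto simp: P_def N_def Z_def)
  have all: "P \<union> N \<union> Z = {..<k} \<and> P \<inter> N = {} \<and> (P \<union> N) \<inter> Z = {}"
  \<comment> \<open>For \<open>k = 0\<close> the value \<open>a\<close> is \<open>1 / 0 = 0\<close>
    and the three levels coincide, but all the sets are empty; otherwise \<open>a > 0\<close>
    separates them.\<close>
  proof (cases "k = 0")
    case True
    then show ?thesis by (auto simp: P_def N_def Z_def)
  next
    case False
    then have "a > 0" by (simp add: a_def)
    then have disj: "P \<inter> N = {}" "(P \<union> N) \<inter> Z = {}"
      by (auto simp: P_def N_def Z_def)
    have "card (P \<union> N \<union> Z) = card {..<k}"
      using disj fin card by (simp add: card_Un_disjoint) presburger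
    then have "P \<union> N \<union> Z = {..<k}"
      by (intro card_subset_eq) (auto simp: P_def N_def Z_def)
    then show ?thesis using disj by simp
  qed
  have split: "(\<Sum>i<k. f (v $ i)) = (k div 2) * f a + (k div 2) * f (- a) + (k mod 2) * f 0"
    for f :: "real \<Rightarrow> real"
  proof -
    have "(\<Sum>i<k. f (v $ i)) = (\<Sum>i\<in>P. f (v $ i)) + (\<Sum>i\<in>N. f (v $ i)) + (\<Sum>i\<in>Z. f (v $ i))"
      using all fin by (metis sum.union_disjoint finite_Un)
    also have "\<dots> = (\<Sum>i\<in>P. f a) + (\<Sum>i\<in>N. f (- a)) + (\<Sum>i\<in>Z. f 0)"
      by (intro arg_cong2[where f = "(+)"] sum.cong) (auto simp: P_def N_def Z_def)
    finally show ?thesis by (simp add: card)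
  qed
  show "\<bar>v $ i\<bar> \<le> 1 / sqrt k" if "i < k" for i
  proof -
    have "i \<in> P \<union> N \<union> Z" using all that by auto
    then show ?thesis by (auto simp: P_def N_def Z_def a_def)
  qed
  show "(\<Sum>i<k. v $ i) = 0" using split[of "\<lambda>x. x"] by simp
  have "(\<Sum>i<k. (v $ i)\<^sup>2) = 2 * real (k div 2) * a\<^sup>2"
    using split[of "\<lambda>x. x\<^sup>2"] by simp
  also have "\<dots> \<le> k * a\<^sup>2"
  proof (rule mult_right_mono)
    have "2 * (k div 2) \<le> k" by simp
    then show "2 * real (k div 2) \<le> real k" by linarith
  qed simp
  also have "\<dots> \<le> 1" by (simp add: a_def power_divide)
  finally show "(\<Sum>i<k. (v $ i)\<^sup>2) \<le> 1" .
qed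

lemma two_layer_net_eq_sum:
  assumes "v \<in> carrier_vec k" "W \<in> carrier_mat k d"
  shows "two_layer_net \<phi> v W x = (\<Sum>i<k. v $ i * \<phi> ((W *\<^sub>v x) $ i))"
  using assms by (auto simp: two_layer_net_def scalar_prod_def lessThan_atLeast0)

text \<open>Second differences of the hidden units are summed with weights at most
  \<open>1 / sqrt k\<close>. Cauchy-Schwarz pairs the perturbations with the initial preactivation
  differences, so \<open>W0\<close> enters only through its image of \<open>x2 - x1\<close>, whose
  size is measured by \<open>K\<close>.\<close>

lemma two_layer_net_difference_bound:
  fixes \<phi> \<phi>' \<phi>'' :: "real \<Rightarrow> real"
  assumes \<phi>: "\<And>z. (\<phi> has_real_derivative \<phi>' z) (at z)"
      "\<And>z. (\<phi>' has_real_derivative \<phi>'' z) (at z)"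
      "\<And>z. \<bar>\<phi>' z\<bar> \<le> \<Gamma>" "\<And>z. \<bar>\<phi>'' z\<bar> \<le> \<Gamma>"
    and x: "x1 \<in> carrier_vec d" "x2 \<in> carrier_vec d"
    and nx: "l2_norm x1 \<le> 1" "l2_norm x2 \<le> 1" "l2_norm (x2 - x1) \<le> e"
    and W: "W \<in> carrier_mat k d" "W0 \<in> carrier_mat k d"
    and v: "v \<in> carrier_vec k" "\<And>i. i < k \<Longrightarrow> \<bar>v $ i\<bar> \<le> 1 / sqrt k"
    and K: "0 \<le> K" and W0: "l2_norm (W0 *\<^sub>v (x2 - x1)) \<le> K * sqrt k * e"
  shows "\<bar>(two_layer_net \<phi> v W x2 - two_layer_net \<phi> v W x1)
      - (two_layer_net \<phi> v W0 x2 - two_layer_net \<phi> v W0 x1)\<bar>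
    \<le> \<Gamma> * (1 + 2 * K) * e * spectral_norm (W - W0)"
proof -
  define D where "D = W - W0"
  have D: "D \<in> carrier_mat k d" using W by (simp add: D_def minus_carrier_mat)
  define p1 p2 q1 q2 where "p1 i = (W0 *\<^sub>v x1) $ i" and "p2 i = (W0 *\<^sub>v x2) $ i"
    and "q1 i = (D *\<^sub>v x1) $ i" and "q2 i = (D *\<^sub>v x2) $ i" for i
  let ?N = "spectral_norm D" and ?L = "\<lambda>f. L2_set f {..<k}"
  have G: "0 \<le> \<Gamma>" using \<phi>(3)[of 0] by linarith
  have N: "0 \<le> ?N" by (rule spectral_norm_nonneg)
  have e: "0 \<le> e" using nx(3) l2_norm_nonneg[of "x2 - x1"] by linarith
  have W_eq: "W = W0 + D" using W by (auto simp: D_def)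
  have Wx: "(W *\<^sub>v x1) $ i = p1 i + q1 i" "(W *\<^sub>v x2) $ i = p2 i + q2 i" if "i < k" for i
    using that W D x unfolding W_eq p1_def p2_def q1_def q2_def
    by (simp_all add: add_mult_distrib_mat_vec[of _ k d])
  have p: "?L (\<lambda>i. p2 i - p1 i) \<le> K * sqrt k * e"
  proof -
    have "?L (\<lambda>i. p2 i - p1 i) = ?L (\<lambda>i. (W0 *\<^sub>v (x2 - x1)) $ i)"
      using W x by (intro L2_set_cong) (simp_all add: p1_def p2_def mult_minus_distrib_mat_vec[of _ k d])
    also have "\<dots> = l2_norm (W0 *\<^sub>v (x2 - x1))"
      using W x by (intro l2_norm_eq_L2_set[symmetric] mult_mat_vec_carrier[of _ k d]) auto
    finally show ?thesis using W0 by simp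
  qed
  have q: "?L (\<lambda>i. q2 i - q1 i) \<le> ?N * e"
  proof -
    have "?L (\<lambda>i. q2 i - q1 i) = ?L (\<lambda>i. (D *\<^sub>v (x2 - x1)) $ i)"
      using D x by (intro L2_set_cong) (simp_all add: q1_def q2_def mult_minus_distrib_mat_vec[of _ k d])
    also have "\<dots> = l2_norm (D *\<^sub>v (x2 - x1))"
      using D x by (intro l2_norm_eq_L2_set[symmetric] mult_mat_vec_carrier[of _ k d]) auto
    also have "\<dots> \<le> ?N * l2_norm (x2 - x1)"
      using x by (intro l2_norm_mult_mat_vec_le_spectral_norm[OF D]) auto
    also have "\<dots> \<le> ?N * e" using nx N by (intro mult_left_mono) auto
    finally show ?thesis .
  qed
  have q1: "?L q1 \<le> ?N" and q2: "?L q2 \<le> ?N"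
    using spectral_norm_upper[OF D x(1) nx(1)] spectral_norm_upper[OF D x(2) nx(2)]
      l2_norm_eq_L2_set[OF mult_mat_vec_carrier[OF D x(1)]]
      l2_norm_eq_L2_set[OF mult_mat_vec_carrier[OF D x(2)]]
    by (simp_all add: q1_def[abs_def] q2_def[abs_def])
  let ?d2 = "\<lambda>i. (\<phi> (p2 i + q2 i) - \<phi> (p1 i + q1 i)) - (\<phi> (p2 i) - \<phi> (p1 i))"
  have diff: "(two_layer_net \<phi> v W x2 - two_layer_net \<phi> v W x1)
      - (two_layer_net \<phi> v W0 x2 - two_layer_net \<phi> v W0 x1) = (\<Sum>i<k. v $ i * ?d2 i)"
    unfolding two_layer_net_eq_sum[OF v(1) W(1)] two_layer_net_eq_sum[OF v(1) W(2)]
      sum_subtractf[symmetric]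
    by (intro sum.cong) (auto simp: Wx algebra_simps simp flip: p1_def p2_def)
  have "\<bar>\<Sum>i<k. v $ i * ?d2 i\<bar> \<le> (\<Sum>i<k. 1 / sqrt k *
      (\<Gamma> * \<bar>q2 i - q1 i\<bar> + \<Gamma> * (\<bar>q1 i\<bar> + \<bar>q2 i\<bar>) * \<bar>p2 i - p1 i\<bar>))"
    using v(2) second_difference_bound[OF \<phi>]
    by (intro order.trans[OF sum_abs] sum_mono) (auto simp only: abs_mult lessThan_iff zero_le_divide_1_iff
        real_sqrt_ge_0_iff of_nat_0_le_iff abs_ge_zero intro!: mult_mono)
  \<comment> \<open>The factor 1 puts the first sum into Cauchy-Schwarz form; the norm
    \<open>sqrt k\<close> of the constant vector then offsets \<open>1 / sqrt k\<close>.\<close>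
  also have "\<dots> = \<Gamma> / sqrt k * ((\<Sum>i<k. \<bar>q2 i - q1 i\<bar> * \<bar>1\<bar>)
      + (\<Sum>i<k. \<bar>q1 i\<bar> * \<bar>p2 i - p1 i\<bar>) + (\<Sum>i<k. \<bar>q2 i\<bar> * \<bar>p2 i - p1 i\<bar>))"
    by (simp add: sum_distrib_left distrib_left distrib_right sum.distrib mult_ac)
  also have "\<dots> \<le> \<Gamma> / sqrt k * (?L (\<lambda>i. q2 i - q1 i) * ?L (\<lambda>_. 1)
      + ?L q1 * ?L (\<lambda>i. p2 i - p1 i) + ?L q2 * ?L (\<lambda>i. p2 i - p1 i))"
    using G by (intro mult_left_mono add_mono L2_set_mult_ineq) auto
  also have "\<dots> \<le> \<Gamma> / sqrt k * (?N * e * sqrt k + ?N * (K * sqrt k * e) + ?N * (K * sqrt k * e))"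
    using G p q q1 q2 N e by (intro mult_left_mono add_mono mult_mono) (auto simp: L2_set_constant)
  also have "\<dots> = \<Gamma> * (1 + 2 * K) * e * ?N * (sqrt k / sqrt k)"
    by (simp add: algebra_simps add_divide_distrib)
  \<comment> \<open>An inequality because \<open>sqrt k / sqrt k\<close> is 0 when
    \<open>k = 0\<close>.\<close>
  also have "\<dots> \<le> \<Gamma> * (1 + 2 * K) * e * ?N * 1"
    using G K e N by (intro mult_left_mono mult_nonneg_nonneg) auto
  finally show ?thesis unfolding diff by (simp add: D_def)
qed

section \<open>Combination on a high-probability event\<close>

theorem theorem2p3:
  fixes c :: real
  assumes "c > 0"
  shows "\<exists>C>0. \<forall>(d::nat) (k::nat) (x1::real vec) (x2::real vec) (\<epsilon>0::real) (v::real vec)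
      (\<phi>::real \<Rightarrow> real) (\<phi>'::real \<Rightarrow> real) (\<phi>''::real \<Rightarrow> real) (\<Gamma>::real)
      (y1::real) (y2::real) (\<delta>::real) (t::real).
    x1 \<in> carrier_vec d \<longrightarrow> x2 \<in> carrier_vec d \<longrightarrow>
    l2_norm x1 = 1 \<longrightarrow> l2_norm x2 = 1 \<longrightarrow> l2_norm (x2 - x1) \<le> \<epsilon>0 \<longrightarrow>
    real k \<ge> c * real d \<longrightarrow> balanced_output_vec k v \<longrightarrow>
    (\<forall>z. (\<phi> has_real_derivative \<phi>' z) (at z)) \<longrightarrow>
    (\<forall>z. (\<phi>' has_real_derivative \<phi>'' z) (at z)) \<longrightarrow>
    (\<forall>z. \<bar>\<phi>' z\<bar> \<le> \<Gamma>) \<longrightarrow> (\<forall>z. \<bar>\<phi>'' z\<bar> \<le> \<Gamma>) \<longrightarrow>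
    \<bar>y2 - y1\<bar> \<ge> \<delta> \<longrightarrow> t \<ge> 0 \<longrightarrow>
    (\<exists>E \<in> sets (gaussian_entries k d).
       measure (gaussian_entries k d) E
         \<ge> 1 - 2 * exp (- (real k + real d)) - 2 * exp (- (t\<^sup>2 / 2)) \<and>
       (\<forall>\<omega>\<in>E. \<forall>W\<in>carrier_mat k d.
          frobenius_norm (W - mat k d \<omega>) \<le> c * sqrt (real k) \<longrightarrow>
          two_layer_net \<phi> v W x1 = y1 \<longrightarrow> two_layer_net \<phi> v W x2 = y2 \<longrightarrow>
          spectral_norm (W - mat k d \<omega>) \<ge> \<delta> / (C * \<Gamma> * \<epsilon>0) - t / 1000))"
proof -
  \<comment> \<open>\<open>K\<close> comes from the chi-square bound
    \<open>8 * (k + d) * e\<^sup>2\<close> and \<open>d \<le> k / c\<close>. \<open>C\<close> must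
    dominate \<open>1 + 2 * K\<close>, and \<open>C / 1000\<close> must dominate the 3 of the
    subgaussian bound.\<close>
  define K where "K = sqrt (8 * (1 + 1 / c))"
  define C where "C = 3000 + 2 * K"
  have K: "0 \<le> K" using assms by (simp add: K_def)
  then have C: "C > 0" by (simp add: C_def)
  show ?thesis
  proof (intro exI[of _ C] conjI allI impI, fact C)
    fix d k :: nat and x1 x2 :: "real vec" and e :: real and v :: "real vec"
      and \<phi> \<phi>' \<phi>'' :: "real \<Rightarrow> real" and \<Gamma> y1 y2 \<delta> t :: real
    assume x: "x1 \<in> carrier_vec d" "x2 \<in> carrier_vec d"
      and nx: "l2_norm x1 = 1" "l2_norm x2 = 1" "l2_norm (x2 - x1) \<le> e"
      and kd: "real k \<ge> c * real d" and v: "balanced_output_vec k v"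
      and \<phi>: "\<forall>z. (\<phi> has_real_derivative \<phi>' z) (at z)"
        "\<forall>z. (\<phi>' has_real_derivative \<phi>'' z) (at z)"
        "\<forall>z. \<bar>\<phi>' z\<bar> \<le> \<Gamma>" "\<forall>z. \<bar>\<phi>'' z\<bar> \<le> \<Gamma>"
      and \<delta>: "\<bar>y2 - y1\<bar> \<ge> \<delta>" and t: "t \<ge> 0"
    define M where "M = gaussian_entries k d"
    have M_eq: "M = PiM ({..<k} \<times> {..<d}) (\<lambda>_. std_normal)"
      by (simp add: M_def gaussian_entries_def)
    interpret M: prob_space M
      unfolding M_eq by (intro prob_space_PiM prob_space_std_normal)
    have G: "0 \<le> \<Gamma>" using \<phi>(3) abs_ge_zero order.trans by blast
    have e: "0 \<le> e" using nx(3) l2_norm_nonneg order.trans by blast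
    have "\<exists>E\<in>sets M. measure M E \<ge> 1 - 2 * exp (- (real k + real d)) - 2 * exp (- (t\<^sup>2 / 2)) \<and>
       (\<forall>\<omega>\<in>E. \<forall>W\<in>carrier_mat k d.
          two_layer_net \<phi> v W x1 = y1 \<longrightarrow> two_layer_net \<phi> v W x2 = y2 \<longrightarrow>
          spectral_norm (W - mat k d \<omega>) \<ge> \<delta> / (C * \<Gamma> * e) - t / 1000)"
    proof (cases "\<Gamma> * e = 0")
      \<comment> \<open>Division by zero gives 0, so the claimed lower bound is at most 0 and the
        whole space serves as the event.\<close>
      case True
      then have "\<delta> / (C * \<Gamma> * e) - t / 1000 \<le> spectral_norm A" for A
        using t spectral_norm_nonneg[of A] by (auto intro: order.trans[of _ 0])
      moreover have "1 - 2 * exp (- (real k + real d)) - 2 * exp (- (t\<^sup>2 / 2)) \<le> M.prob (space M)"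
        using exp_ge_zero[of "- (real k + real d)"] exp_ge_zero[of "- (t\<^sup>2 / 2)"]
        unfolding M.prob_space by linarith
      ultimately show ?thesis by blast
    next
      case False
      then have "\<Gamma> > 0" "e > 0" using G e by auto
      then have \<sigma>: "\<Gamma> * e > 0" by simp
      define h where "h j = (x2 - x1) $ j" for j
      \<comment> \<open>\<open>g\<close> is the activation gap of one hidden unit with weight row
        \<open>r\<close>, \<open>S\<close> the output gap of the initial network, and
        \<open>Q\<close> the squared norm of the image of \<open>x2 - x1\<close> under the initial
        matrix.\<close>
      define g where "g r = \<phi> (\<Sum>j<d. x2 $ j * r j) - \<phi> (\<Sum>j<d. x1 $ j * r j)" for r :: "nat \<Rightarrow> real"
      define S where "S \<omega> = (\<Sum>i<k. v $ i * g (\<lambda>j\<in>{..<d}. \<omega> (i, j)))" for \<omega> :: "nat \<times> nat \<Rightarrow> real"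
      define Q where "Q \<omega> = (\<Sum>i<k. (\<Sum>j<d. h j * \<omega> (i, j))\<^sup>2)" for \<omega> :: "nat \<times> nat \<Rightarrow> real"
      define n where "n = real k + real d"
      have v_car: "v \<in> carrier_vec k" using v by (simp add: balanced_output_vec_def)
      have h2: "(\<Sum>j<d. (h j)\<^sup>2) \<le> e\<^sup>2"
      proof -
        have "l2_norm (x2 - x1) = L2_set h {..<d}"
          using x by (subst l2_norm_eq_L2_set[of _ d]) (auto simp: h_def[abs_def])
        then show ?thesis
          using nx(3) sqrt_le_D by (simp add: L2_set_def)
      qed
      have cont: "continuous_on UNIV \<phi>"
        using \<phi>(1) DERIV_isCont by (simp add: continuous_on_eq_continuous_at) blast
      then have \<phi>_meas [measurable]: "\<phi> \<in> borel_measurable borel"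
        by (rule borel_measurable_continuous_onI)
      have g_meas: "g \<in> borel_measurable (PiM {..<d} (\<lambda>_. std_normal))"
        unfolding g_def[abs_def] by measurable
      have g_dom: "\<bar>g r\<bar> \<le> \<bar>\<Sum>j<d. \<Gamma> * h j * r j\<bar>" for r
      proof -
        have "\<bar>g r\<bar> \<le> \<Gamma> * \<bar>(\<Sum>j<d. x2 $ j * r j) - (\<Sum>j<d. x1 $ j * r j)\<bar>"
          unfolding g_def using \<phi>(1,3) field_differentiable_bound[of UNIV \<phi> \<phi>' \<Gamma>] by auto
        also have "(\<Sum>j<d. x2 $ j * r j) - (\<Sum>j<d. x1 $ j * r j) = (\<Sum>j<d. h j * r j)"
          using x by (simp add: h_def left_diff_distrib sum_subtractf)
        also have "\<Gamma> * \<bar>\<dots>\<bar> = \<bar>\<Sum>j<d. \<Gamma> * h j * r j\<bar>"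
          using G by (simp add: abs_mult mult.assoc flip: sum_distrib_left)
        finally show ?thesis .
      qed
      have \<Gamma>h2: "(\<Sum>j<d. (\<Gamma> * h j)\<^sup>2) \<le> (\<Gamma> * e)\<^sup>2"
        using h2 by (simp add: power_mult_distrib mult_left_mono flip: sum_distrib_left)
      have S_meas [measurable]: "S \<in> borel_measurable M"
        unfolding S_def[abs_def] M_eq
        by (intro borel_measurable_sum borel_measurable_times borel_measurable_const
            measurable_compose[OF measurable_row_PiM g_meas]) auto
      have Q_meas [measurable]: "Q \<in> borel_measurable M"
      proof -
        have "(\<lambda>\<omega>. \<omega> (i, j)) \<in> borel_measurable M" if "i < k" "j < d" for i j
          using measurable_component_singleton[of "(i, j)" "{..<k} \<times> {..<d}" "\<lambda>_. std_normal"] that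
          unfolding M_eq by simp
        then show ?thesis
          unfolding Q_def[abs_def]
          by (intro borel_measurable_sum borel_measurable_power borel_measurable_times
              borel_measurable_const) auto
      qed
      define B1 B2 B3 where "B1 = {\<omega>\<in>space M. S \<omega> \<ge> 3 * (\<Gamma> * e) * t}"
        and "B2 = {\<omega>\<in>space M. - S \<omega> \<ge> 3 * (\<Gamma> * e) * t}"
        and "B3 = {\<omega>\<in>space M. Q \<omega> \<ge> 8 * n * e\<^sup>2}"
      have B [measurable]: "B1 \<in> sets M" "B2 \<in> sets M" "B3 \<in> sets M"
        unfolding B1_def B2_def B3_def by measurable
      have p1: "M.prob B1 \<le> exp (- (t\<^sup>2 / 2))"
        unfolding B1_def S_def M_eq
        by (rule prob_weighted_sum_rows_ge[OF _ _ \<sigma> \<Gamma>h2 g_meas g_dom])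
          (use balanced_output_vec_abs_sums[OF v] t in auto)
      \<comment> \<open>The lower tail is the upper tail for the weights \<open>- v\<close>, which
        also sum to zero and have the same squares.\<close>
      have p2: "M.prob B2 \<le> exp (- (t\<^sup>2 / 2))"
        unfolding B2_def S_def M_eq sum_negf[symmetric] mult_minus_left[symmetric]
        by (rule prob_weighted_sum_rows_ge[OF _ _ \<sigma> \<Gamma>h2 g_meas g_dom])
          (use balanced_output_vec_abs_sums[OF v] t in \<open>auto simp: sum_negf\<close>)
      have p3: "M.prob B3 \<le> exp (- n)"
        unfolding B3_def Q_def M_eq
        by (rule prob_sum_rows_square_ge) (use \<open>e > 0\<close> h2 in \<open>auto simp: n_def\<close>)
      define E where "E = space M - (B1 \<union> B2 \<union> B3)"
      have "M.prob (B1 \<union> B2 \<union> B3) \<le> M.prob B1 + M.prob B2 + M.prob B3"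
        using measure_Un_le[of "B1 \<union> B2" M B3] measure_Un_le[of B1 M B2]
        by auto
      also have "\<dots> \<le> 2 * exp (- n) + 2 * exp (- (t\<^sup>2 / 2))"
        using p1 p2 p3 exp_ge_zero[of "- n"] by linarith
      finally have "M.prob E \<ge> 1 - 2 * exp (- n) - 2 * exp (- (t\<^sup>2 / 2))"
        unfolding E_def by (subst M.prob_compl) auto
      moreover have "spectral_norm (W - mat k d \<omega>) \<ge> \<delta> / (C * \<Gamma> * e) - t / 1000"
        if \<omega>: "\<omega> \<in> E" and W: "W \<in> carrier_mat k d"
          and y: "two_layer_net \<phi> v W x1 = y1" "two_layer_net \<phi> v W x2 = y2" for \<omega> W
      proof -
        let ?W0 = "mat k d \<omega>" and ?N = "spectral_norm (W - mat k d \<omega>)"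
        have W0x: "(?W0 *\<^sub>v z) $ i = (\<Sum>j<d. z $ j * \<omega> (i, j))" if "z \<in> carrier_vec d" "i < k" for z i
          using that by (subst index_mult_mat_vec_sum[of _ k d]) auto
        have S_eq: "two_layer_net \<phi> v ?W0 x2 - two_layer_net \<phi> v ?W0 x1 = S \<omega>"
          unfolding S_def g_def using W0x x v_car
          by (simp add: two_layer_net_eq_sum[of v k _ d] right_diff_distrib sum_subtractf)
        have S_le: "\<bar>S \<omega>\<bar> \<le> 3 * (\<Gamma> * e) * t" and Q_le: "Q \<omega> \<le> 8 * n * e\<^sup>2"
          using \<omega> by (auto simp: E_def B1_def B2_def B3_def)
        have "l2_norm (?W0 *\<^sub>v (x2 - x1)) = sqrt (Q \<omega>)"
          using W0x[of "x2 - x1"] x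
          by (subst l2_norm_eq_L2_set[OF mult_mat_vec_carrier[of _ k d]]) (auto simp: L2_set_def Q_def h_def)
        also have "\<dots> \<le> sqrt (8 * ((1 + 1 / c) * k) * e\<^sup>2)"
        proof -
          have "n \<le> (1 + 1 / c) * k"
            using kd \<open>c > 0\<close> by (simp add: n_def field_simps)
          then have "8 * n * e\<^sup>2 \<le> 8 * ((1 + 1 / c) * k) * e\<^sup>2"
            by (intro mult_right_mono mult_left_mono) auto
          then show ?thesis using Q_le by simp
        qed
        also have "\<dots> = K * sqrt k * e"
          using e by (simp only: K_def real_sqrt_mult real_sqrt_abs abs_of_nonneg mult.assoc)
        finally have W0h: "l2_norm (?W0 *\<^sub>v (x2 - x1)) \<le> K * sqrt k * e" .
        have "\<bar>(y2 - y1) - S \<omega>\<bar> \<le> \<Gamma> * (1 + 2 * K) * e * ?N"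
          unfolding y[symmetric] S_eq[symmetric]
          using \<phi> x nx W v_car balanced_output_vec_abs_sums(1)[OF v] K W0h
          by (intro two_layer_net_difference_bound[where \<phi>' = \<phi>' and \<phi>'' = \<phi>'']) auto
        then have "\<delta> \<le> \<Gamma> * (1 + 2 * K) * e * ?N + 3 * (\<Gamma> * e) * t"
          using S_le \<delta> by linarith
        also have "\<dots> = \<Gamma> * e * ((1 + 2 * K) * ?N + 3 * t)"
          by (simp add: algebra_simps)
        also have "\<dots> \<le> \<Gamma> * e * (C * (?N + t / 1000))"
        proof (rule mult_left_mono)
          \<comment> \<open>Exactly the difference of the two sides of the inequality to be
            shown.\<close>
          have "0 \<le> 2999 * ?N + 2 * K * (t / 1000)"
            using K t spectral_norm_nonneg by simp
          then show "(1 + 2 * K) * ?N + 3 * t \<le> C * (?N + t / 1000)"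
            by (simp add: C_def algebra_simps)
        qed (use \<sigma> in simp)
        finally have "\<delta> \<le> (?N + t / 1000) * (C * \<Gamma> * e)"
          by (simp add: mult_ac)
        then have "\<delta> / (C * \<Gamma> * e) \<le> ?N + t / 1000"
          using C \<open>\<Gamma> > 0\<close> \<open>e > 0\<close> by (subst pos_divide_le_eq) auto
        then show ?thesis by simp
      qed
      moreover have "E \<in> sets M" unfolding E_def by measurable
      ultimately show ?thesis unfolding n_def by blast
    qed
    then show "\<exists>E \<in> sets (gaussian_entries k d).
       measure (gaussian_entries k d) E
         \<ge> 1 - 2 * exp (- (real k + real d)) - 2 * exp (- (t\<^sup>2 / 2)) \<and>
       (\<forall>\<omega>\<in>E. \<forall>W\<in>carrier_mat k d.
          frobenius_norm (W - mat k d \<omega>) \<le> c * sqrt (real k) \<longrightarrow>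
          two_layer_net \<phi> v W x1 = y1 \<longrightarrow> two_layer_net \<phi> v W x2 = y2 \<longrightarrow>
          spectral_norm (W - mat k d \<omega>) \<ge> \<delta> / (C * \<Gamma> * e) - t / 1000)"
      unfolding M_def by blast
  qed
qed

end
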